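(* Let $\mathcal{P}$ be a hereditary permutation property. For every real $\varepsilon_0>0$ there exists a positive integer $M_0$ such that the following holds: if $\pi$ is a permutation of order at least $M_0$ with $\mathrm{dist}_K(\pi,\mathcal{P})\ge\varepsilon_0$, then a random subpermutation of $\pi$ of order $M_0$ has the property $\mathcal{P}$ with probability at most $\varepsilon_0$.
   Context: $[N]$ denotes $\{1,\ldots,N\}$. A permutation of order $N$ is a bijection $\pi:[N]\to[N]$; its order is denoted $|\pi|$. If $\pi$ is a permutation of order $N$ and $X=\{x_1<\cdots<x_{|X|}\}\subseteq[N]$, the subpermutation of $\pi$ induced by $X$ is the permutation $\pi'$ of order $|X|$ such that $\pi'(i)<\pi'(j)$ if and only if $\pi(x_i)<\pi(x_j)$ for all $i,j\in[|X|]$. A random subpermutation of $\pi$ of order $M_0$ is the subpermutation of $\pi$ induced by a uniformly random $M_0$-element subset of $[|\pi|]$. A permutation property $\mathcal{P}$ is a set of permutations; $\pi$ has the property $\mathcal{P}$ if $\pi\in\mathcal{P}$. The property $\mathcal{P}$ is hereditary if every subpermutation of every $\pi\in\mathcal{P}$ is in $\mathcal{P}$. For permutations $\pi,\sigma$ of the same order $N$, the Kendall's tau distance is $$\mathrm{dist}_K(\pi,\sigma)=\frac{|\{(i,j)\in[N]\times[N] : \pi(i)<\pi(j),\ \sigma(i)>\sigma(j)\}|}{\binom N2}$$ (taken to be $0$ if $N=1$), and $\mathrm{dist}_K(\pi,\mathcal{P})=\min_{\sigma\in\mathcal{P},\,|\sigma|=|\pi|}\mathrm{dist}_K(\pi,\sigma)$,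 where the minimum over the empty set is $+\infty$. *)

theory Defs
  imports
    "HOL-Probability.Probability"
    "HOL-Combinatorics.Permutations"
begin

text \<open>
  The order is recorded alongside the function, because a function that permutes \<open>{1..N}\<close> and is
  the identity elsewhere also permutes \<open>{1..N'}\<close> for every \<open>N' \<ge> N\<close>.
\<close>

type_synonym nperm = "nat \<times> (nat \<Rightarrow> nat)"

definition nperms :: "nperm set" where
  "nperms = {(N, p). p permutes {1..N}}"

abbreviation perm_order :: "nperm \<Rightarrow> nat" where
  "perm_order \<pi> \<equiv> fst \<pi>"

text \<open>\<open>nth_elem X i\<close> is the \<open>i\<close>-th smallest element of \<open>X\<close>, counting from 1.\<close>

definition nth_elem :: "nat set \<Rightarrow> nat \<Rightarrow> nat" where
  "nth_elem X i = sorted_list_of_set X ! (i - 1)"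

definition is_subperm :: "nperm \<Rightarrow> nat set \<Rightarrow> nperm \<Rightarrow> bool" where
  "is_subperm \<pi> X \<pi>' \<longleftrightarrow>
     \<pi>' \<in> nperms \<and> perm_order \<pi>' = card X \<and>
     (\<forall>i \<in> {1..card X}. \<forall>j \<in> {1..card X}.
        snd \<pi>' i < snd \<pi>' j \<longleftrightarrow> snd \<pi> (nth_elem X i) < snd \<pi> (nth_elem X j))"

definition subperm :: "nperm \<Rightarrow> nat set \<Rightarrow> nperm" where
  "subperm \<pi> X = (THE \<pi>'. is_subperm \<pi> X \<pi>')"

text \<open>The induced subpermutation exists and is unique, so the description above is proper.\<close>

lemma permutes_value_eq_card:
  fixes p :: "nat \<Rightarrow> nat"
  assumes p: "p permutes {1..n}" and i: "i \<in> {1..n}"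
  shows "p i = card {j \<in> {1..n}. p j < p i} + 1"
proof -
  have img: "p ` {1..n} = {1..n}" using p by (rule permutes_image)
  have pi: "p i \<in> {1..n}" using i img by blast
  have "p ` {j \<in> {1..n}. p j < p i} = {k \<in> p ` {1..n}. k < p i}" by blast
  also have "\<dots> = {1..<p i}" unfolding img using pi by auto
  finally have "card {j \<in> {1..n}. p j < p i} = card {1..<p i}"
    using p by (metis card_image permutes_inj_on)
  then show ?thesis using pi by simp
qed

lemma nth_elem_bij:
  assumes "finite X"
  shows "bij_betw (nth_elem X) {1..card X} X"
proof -
  have "bij_betw (\<lambda>i. i - 1) {1..card X} {..<card X}"
    by (rule bij_betw_byWitness[where f' = Suc]) auto
  moreover have "bij_betw ((!) (sorted_list_of_set X)) {..<card X} X"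
    using assms by (intro bij_betw_nth) auto
  ultimately have "bij_betw ((!) (sorted_list_of_set X) \<circ> (\<lambda>i. i - 1)) {1..card X} X"
    by (rule bij_betw_trans)
  then show ?thesis by (simp add: nth_elem_def[abs_def] comp_def)
qed

lemma is_subperm_unique_exists:
  assumes \<pi>: "\<pi> \<in> nperms" and X: "X \<subseteq> {1..perm_order \<pi>}"
  shows "\<exists>!\<pi>'. is_subperm \<pi> X \<pi>'"
proof (rule ex_ex1I)
  have fin: "finite X" using X finite_subset by blast
  let ?n = "card X"
  define g where "g i = snd \<pi> (nth_elem X i)" for i
  have inj: "inj_on g {1..?n}"
  proof -
    have "inj_on (snd \<pi>) X"
      using \<pi> by (auto simp: nperms_def intro: permutes_inj_on)
    with nth_elem_bij[OF fin] have "inj_on (snd \<pi> \<circ> nth_elem X) {1..?n}"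
      by (metis bij_betw_def comp_inj_on)
    then show ?thesis by (simp add: g_def[abs_def] comp_def)
  qed
  define r where "r i = card {j \<in> {1..?n}. g j < g i}" for i
  have mono: "r i < r j" if "g i < g j" "i \<in> {1..?n}" for i j
    unfolding r_def
  proof (rule psubset_card_mono)
    have "i \<in> {k \<in> {1..?n}. g k < g j}" "i \<notin> {k \<in> {1..?n}. g k < g i}"
      using that by auto
    moreover have "{k \<in> {1..?n}. g k < g i} \<subseteq> {k \<in> {1..?n}. g k < g j}"
      using that by auto
    ultimately show "{k \<in> {1..?n}. g k < g i} \<subset> {k \<in> {1..?n}. g k < g j}" by blast
  qed simp
  have iff: "r i < r j \<longleftrightarrow> g i < g j" if "i \<in> {1..?n}" "j \<in> {1..?n}" for i j
  proof (cases "g i" "g j" rule: linorder_cases)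
    case equal
    then have "i = j" using inj that by (meson inj_onD)
    then show ?thesis by simp
  next
    case greater
    then show ?thesis using mono[of j i] that by linarith
  qed (use mono that in blast)
  define q where "q i = (if i \<in> {1..?n} then r i + 1 else i)" for i
  have "q permutes {1..?n}"
  proof (rule bij_imp_permutes)
    have sub: "q ` {1..?n} \<subseteq> {1..?n}"
    proof
      fix y assume "y \<in> q ` {1..?n}"
      then obtain i where "i \<in> {1..?n}" "y = q i" by blast
      then have i: "i \<in> {1..?n}" "y = r i + 1" by (simp_all add: q_def)
      have "i \<notin> {j \<in> {1..?n}. g j < g i}" by simp
      then have "{j \<in> {1..?n}. g j < g i} \<subset> {1..?n}" using i(1) by blast
      then have "r i < card {1..?n}" unfolding r_def by (rule psubset_card_mono[OF finite_atLeastAtMost])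
      then show "y \<in> {1..?n}" using i by simp
    qed
    have "inj_on q {1..?n}"
    proof (rule inj_onI)
      fix i j assume ij: "i \<in> {1..?n}" "j \<in> {1..?n}" "q i = q j"
      then have "r i = r j" by (simp add: q_def split: if_splits)
      then have "g i = g j" using iff[of i j] iff[of j i] ij by auto
      then show "i = j" using inj ij by (meson inj_onD)
    qed
    then show "bij_betw q {1..?n} {1..?n}"
      using sub by (simp add: bij_betw_def endo_inj_surj)
  qed (auto simp: q_def)
  then show "\<exists>\<pi>'. is_subperm \<pi> X \<pi>'"
    using iff by (intro exI[of _ "(?n, q)"]) (auto simp: is_subperm_def nperms_def q_def g_def)
next
  fix \<sigma> \<tau> assume "is_subperm \<pi> X \<sigma>" "is_subperm \<pi> X \<tau>"
  then obtain s t where st: "\<sigma> = (card X, s)" "\<tau> = (card X, t)"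
    and s: "s permutes {1..card X}" and t: "t permutes {1..card X}"
    and same: "\<And>i j. i \<in> {1..card X} \<Longrightarrow> j \<in> {1..card X} \<Longrightarrow> s i < s j \<longleftrightarrow> t i < t j"
    by (cases \<sigma>; cases \<tau>) (auto simp: is_subperm_def nperms_def)
  have "s i = t i" for i
  proof (cases "i \<in> {1..card X}")
    case True
    then have "{j \<in> {1..card X}. s j < s i} = {j \<in> {1..card X}. t j < t i}"
      using same by blast
    then show ?thesis
      using permutes_value_eq_card[OF s True] permutes_value_eq_card[OF t True] by simp
  next
    case False
    then show ?thesis using s t by (simp add: permutes_not_in)
  qed
  then show "\<sigma> = \<tau>" using st by auto
qed

lemma is_subperm_subperm:
  assumes "\<pi> \<in> nperms" "X \<subseteq> {1..perm_order \<pi>}"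
  shows "is_subperm \<pi> X (subperm \<pi> X)"
  unfolding subperm_def using is_subperm_unique_exists[OF assms] by (rule theI')

text \<open>
  The empty set is never required as \<open>X\<close>, so a hereditary property may or may not contain the
  permutation of order 0.
\<close>

definition hereditary :: "nperm set \<Rightarrow> bool" where
  "hereditary P \<longleftrightarrow>
     (\<forall>\<pi> \<in> P. \<forall>X. X \<subseteq> {1..perm_order \<pi>} \<and> X \<noteq> {} \<longrightarrow> subperm \<pi> X \<in> P)"

definition random_subperm :: "nat \<Rightarrow> nperm \<Rightarrow> nperm pmf" where
  "random_subperm M \<pi> =
     map_pmf (subperm \<pi>) (pmf_of_set {X. X \<subseteq> {1..perm_order \<pi>} \<and> card X = M})"

text \<open>
  Only used when both permutations have the same order. For order 1 the denominator is 0 and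
  \<open>x / 0 = 0\<close> gives the value 0.
\<close>

definition dist_K :: "nperm \<Rightarrow> nperm \<Rightarrow> real" where
  "dist_K \<pi> \<sigma> =
     real (card {(i, j) \<in> {1..perm_order \<pi>} \<times> {1..perm_order \<pi>}.
                   snd \<pi> i < snd \<pi> j \<and> snd \<sigma> i > snd \<sigma> j})
       / real (perm_order \<pi> choose 2)"

text \<open>
  There are finitely many permutations of each order, so the infimum is attained unless the index
  set is empty, in which case it is \<open>\<infinity>\<close>.
\<close>

definition dist_K_property :: "nperm \<Rightarrow> nperm set \<Rightarrow> ereal" where
  "dist_K_property \<pi> P =
     (INF \<sigma> \<in> {\<sigma> \<in> P. perm_order \<sigma> = perm_order \<pi>}. ereal (dist_K \<pi> \<sigma>))"

end

theory Submission imports Defs begin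

text \<open>
  Colour each position \<open>i\<close> of \<open>\<pi>\<close> by the horizontal strip, one of \<open>K\<close>, that contains \<open>\<pi> i\<close>. If
  \<open>\<sigma>\<close> respects the order of the strips on all but few positions, only pairs within one strip or
  meeting an exceptional position count in the distance of \<open>\<pi>\<close> and \<open>\<sigma>\<close>, so it is small. Hence it
  suffices to show that \<open>P\<close> realises a slight recolouring of the word of \<open>\<pi>\<close>.

  Cut the positions into \<open>q\<close> cells and allow a set of colours in each cell. If some word with
  allowed colours is not realised in \<open>P\<close>, one of length at most \<open>n\<close> is not, where \<open>n\<close> depends only
  on \<open>q\<close> and \<open>K\<close>. Refine the cells repeatedly, each cell into many more than \<open>n\<close> children, and
  follow the colours that have remained dense at a position through all refinements so far. These
  sets only shrink, so at some level they stay the same for most positions. There most positions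
  lie in a cell with at least \<open>n\<close> children in which all its colours are still dense. A large random
  sample meets every dense colour in every child and therefore contains all allowed words of length
  at most \<open>n\<close>. If it has the property with probability more than \<open>\<epsilon>\<^sub>0\<close>, then some sample both meets
  everything and is in \<open>P\<close>; so \<open>P\<close> realises all allowed words, in particular one of length \<open>|\<pi>|\<close>
  that agrees with that of \<open>\<pi>\<close> almost everywhere.
\<close>

section \<open>Cells of positions\<close>

text \<open>The divisor \<open>Suc N\<close> keeps the index below \<open>q\<close> for every
  \<open>i \<le> N\<close>. Rounding down makes two partitions nest without error whenever one
  number of cells divides the other. The same map cuts positions into cells and values into
  strips.\<close>

definition cell :: "nat \<Rightarrow> nat \<Rightarrow> nat \<Rightarrow> nat" where
  "cell N q i = i * q div Suc N"

lemma cell_less: "0 < q \<Longrightarrow> i \<le> N \<Longrightarrow> cell N q i < q"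
  unfolding cell_def by (rule less_mult_imp_div_less) (simp add: mult.commute add_strict_increasing)

lemma cell_mono: "i \<le> j \<Longrightarrow> cell N q i \<le> cell N q j"
  unfolding cell_def by (intro div_le_mono mult_le_mono1)

lemma less_if_cell_less: "cell N q i < cell N q j \<Longrightarrow> i < j"
  using cell_mono[of j i N q] by linarith

text \<open>Rounding down twice is rounding down once by the product of the divisors, and then the
  factor \<open>m\<close> cancels.\<close>

lemma cell_mult: "0 < m \<Longrightarrow> cell N (q * m) i div m = cell N q i"
proof -
  assume m: "0 < m"
  have "i * (q * m) div Suc N div m = (i * q) * m div (Suc N * m)"
    using div_mult2_eq[of "i * (q * m)" "Suc N" m] by (simp only: mult.assoc)
  also have "\<dots> = i * q div Suc N" using m by (simp only: div_mult_mult2)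
  finally show ?thesis unfolding cell_def .
qed

lemma cell_eq_dvd:
  assumes "q dvd r" "0 < r" "cell N r x = cell N r y"
  shows "cell N q x = cell N q y"
proof -
  obtain m where m: "r = q * m" using assms(1) by blast
  then have "0 < m" using assms(2) by simp
  then show ?thesis using cell_mult[of m N q] assms(3) m by metis
qed

text \<open>The products \<open>x * q\<close> over one cell lie in one interval of length
  \<open>Suc N\<close>, so two members differ by at most \<open>Suc N div q\<close>.\<close>

lemma card_cell_le:
  assumes q: "0 < q"
  shows "card {i \<in> {1..N}. cell N q i = h} \<le> Suc N div q + 1"
proof (cases "{i \<in> {1..N}. cell N q i = h} = {}")
  case False
  define A where "A = {i \<in> {1..N}. cell N q i = h}"
  define a where "a = Min A"
  have fin: "finite A" "A \<noteq> {}" using False by (auto simp: A_def)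
  have aA: "a \<in> A" using fin by (simp add: a_def)
  have "A \<subseteq> {a..a + Suc N div q}"
  proof
    fix x assume x: "x \<in> A"
    then have ax: "a \<le> x" using fin by (simp add: a_def)
    have "x * q < h * Suc N + Suc N"
      using x dividend_less_div_times[of "Suc N" "x * q"] by (auto simp: A_def cell_def)
    moreover have "h * Suc N \<le> a * q"
      using aA div_times_less_eq_dividend[of "a * q" "Suc N"] unfolding A_def cell_def by auto
    ultimately have "x * q < a * q + Suc N" by linarith
    then have "(x - a) * q < Suc N" using ax by (simp add: diff_mult_distrib)
    then have "x - a \<le> Suc N div q" using q by (simp add: less_eq_div_iff_mult_less_eq)
    then show "x \<in> {a..a + Suc N div q}" using ax by auto
  qed
  then have "card A \<le> card {a..a + Suc N div q}" by (rule card_mono[rotated]) simp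
  then show ?thesis by (simp add: A_def)
next
  case True
  then show ?thesis by (metis card.empty le0)
qed

section \<open>Increasing enumeration of a finite set\<close>

lemma nth_elem_in: "finite X \<Longrightarrow> i \<in> {1..card X} \<Longrightarrow> nth_elem X i \<in> X"
  using nth_elem_bij[of X] by (auto simp: bij_betw_def)

lemma nth_elem_strict_mono:
  "finite X \<Longrightarrow> i \<in> {1..card X} \<Longrightarrow> j \<in> {1..card X} \<Longrightarrow> i < j \<Longrightarrow> nth_elem X i < nth_elem X j"
  using sorted_wrt_nth_less[OF strict_sorted_list_of_set[of X], of "i - 1" "j - 1"]
  unfolding nth_elem_def by auto

lemma nth_elem_image:
  assumes z: "strict_mono_on {1..n} z" and i: "i \<in> {1..n}"
  shows "nth_elem (z ` {1..n}) i = z i"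
proof -
  have "sorted_wrt (<) (map z [1..<Suc n])"
    unfolding sorted_wrt_map
    by (rule sorted_wrt_mono_rel[of _ "(<)"])
       (use z in \<open>auto simp: strict_mono_on_def simp del: upt_Suc\<close>)
  then have "sorted_list_of_set (set (map z [1..<Suc n])) = map z [1..<Suc n]"
    by (intro sorted_list_of_set.idem_if_sorted_distinct)
       (auto simp: strict_sorted_iff simp del: upt_Suc)
  then have "sorted_list_of_set (z ` {1..n}) = map z [1..<Suc n]"
    by (simp add: atLeastLessThanSuc_atLeastAtMost del: upt_Suc)
  then show ?thesis using i by (auto simp: nth_elem_def simp del: upt_Suc)
qed

section \<open>Words realised by a property\<close>

text \<open>Equal letters impose no constraint: a word prescribes the order between strips, not the
  order inside a strip.\<close>

definition realizes :: "nperm set \<Rightarrow> nat \<Rightarrow> (nat \<Rightarrow> nat) \<Rightarrow> bool" where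
  "realizes P n w \<longleftrightarrow>
     (\<exists>s. (n, s) \<in> P \<and> (\<forall>i \<in> {1..n}. \<forall>j \<in> {1..n}. w i < w j \<longrightarrow> s i < s j))"

text \<open>\<open>b\<close> places the letters of the word \<open>w\<close> in cells, from left to right; \<open>S\<close> lists the allowed letters.\<close>

definition fits :: "nat \<Rightarrow> (nat \<Rightarrow> nat set) \<Rightarrow> nat \<Rightarrow> (nat \<Rightarrow> nat) \<Rightarrow> (nat \<Rightarrow> nat) \<Rightarrow> bool" where
  "fits L S n b w \<longleftrightarrow>
     (\<forall>i \<in> {1..n}. b i < L \<and> w i \<in> S (b i)) \<and> mono_on {1..n} b"

definition full :: "nperm set \<Rightarrow> nat \<Rightarrow> (nat \<Rightarrow> nat set) \<Rightarrow> bool" where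
  "full P L S \<longleftrightarrow> (\<forall>n b w. n \<ge> 1 \<and> fits L S n b w \<longrightarrow> realizes P n w)"

text \<open>A compactness argument: there are only finitely many choices of allowed letters
  \<open>S\<close>, so it suffices to take one unrealised word for each \<open>S\<close> that is not
  full and the maximum of their lengths.\<close>

lemma full_bound:
  "\<exists>n \<ge> 1. \<forall>S \<in> {..<L} \<rightarrow>\<^sub>E Pow {..<K}. \<not> full P L S \<longrightarrow>
     (\<exists>n' b w. n' \<in> {1..n} \<and> fits L S n' b w \<and> \<not> realizes P n' w)"
proof -
  define F where "F = {S \<in> {..<L} \<rightarrow>\<^sub>E Pow {..<K}. \<not> full P L S}"
  have fin: "finite F"
    unfolding F_def by (rule finite_subset[OF _ finite_PiE[of "{..<L}" "\<lambda>_. Pow {..<K}"]]) auto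
  have "\<forall>S \<in> F. \<exists>n. n \<ge> 1 \<and> (\<exists>b w. fits L S n b w \<and> \<not> realizes P n w)"
    by (auto simp: F_def full_def)
  then obtain f where f: "\<And>S. S \<in> F \<Longrightarrow> f S \<ge> 1 \<and> (\<exists>b w. fits L S (f S) b w \<and> \<not> realizes P (f S) w)"
    by metis
  define n where "n = Max (insert 1 (f ` F))"
  have "n \<ge> 1" using fin by (simp add: n_def)
  moreover have "\<exists>n' b w. n' \<in> {1..n} \<and> fits L S n' b w \<and> \<not> realizes P n' w" if "S \<in> F" for S
  proof -
    have "f S \<in> {1..n}" using fin that f[OF that] by (simp add: n_def)
    then show ?thesis using f[OF that] by blast
  qed
  ultimately show ?thesis unfolding F_def by blast
qed

text \<open>A pattern found inside the sample \<open>X\<close> is a subpermutation of the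
  subpermutation induced by \<open>X\<close>, hence in \<open>P\<close> by heredity. The bound
  \<open>n \<ge> 1\<close> keeps the inducing set \<open>Z\<close> nonempty, as
  \<open>hereditary\<close> asks.\<close>

lemma realizes_sub:
  assumes P: "P \<subseteq> nperms" "hereditary P"
    and \<pi>: "\<pi> \<in> nperms" and X: "X \<subseteq> {1..perm_order \<pi>}" "subperm \<pi> X \<in> P"
    and n: "n \<ge> 1" and y: "strict_mono_on {1..n} y" "y ` {1..n} \<subseteq> X"
    and w: "\<And>i j. i \<in> {1..n} \<Longrightarrow> j \<in> {1..n} \<Longrightarrow> w i < w j \<Longrightarrow> snd \<pi> (y i) < snd \<pi> (y j)"
  shows "realizes P n w"
proof -
  have fX: "finite X" using X finite_subset by blast
  obtain \<sigma> where \<sigma>: "\<sigma> = subperm \<pi> X" by simp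
  have sub: "is_subperm \<pi> X \<sigma>" unfolding \<sigma> by (rule is_subperm_subperm[OF \<pi> X(1)])
  have \<sigma>P: "\<sigma> \<in> P" using X(2) by (simp add: \<sigma>)
  \<comment> \<open>The rank of \<open>y i\<close> inside \<open>X\<close>, that is, its position in
    \<open>\<sigma>\<close>.\<close>
  define z where "z i = inv_into {1..card X} (nth_elem X) (y i)" for i
  have z: "z i \<in> {1..card X}" "nth_elem X (z i) = y i" if "i \<in> {1..n}" for i
  proof -
    have "y i \<in> nth_elem X ` {1..card X}"
      using y(2) that nth_elem_bij[OF fX] by (auto simp: bij_betw_def)
    then show "z i \<in> {1..card X}" "nth_elem X (z i) = y i"
      unfolding z_def by (rule inv_into_into, rule f_inv_into_f)
  qed
  have zmono: "strict_mono_on {1..n} z"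
  proof (rule strict_mono_onI)
    fix i j assume ij: "i \<in> {1..n}" "j \<in> {1..n}" "i < j"
    have "y i < y j" using y(1) ij by (auto simp: strict_mono_on_def)
    then show "z i < z j"
      using z[OF ij(1)] z[OF ij(2)] nth_elem_strict_mono[OF fX, of "z j" "z i"]
      by (metis linorder_less_linear order_less_asym)
  qed
  define Z where "Z = z ` {1..n}"
  have oX: "perm_order \<sigma> = card X" using sub by (simp add: is_subperm_def)
  have Zsub: "Z \<subseteq> {1..perm_order \<sigma>}" using z(1) oX by (auto simp: Z_def)
  have cZ: "card Z = n"
    using strict_mono_on_imp_inj_on[OF zmono] by (simp add: Z_def card_image)
  define \<tau> where "\<tau> = subperm \<sigma> Z"
  have "Z \<noteq> {}" using n by (simp add: Z_def)
  then have "\<tau> \<in> P" using P(2) \<sigma>P Zsub unfolding hereditary_def \<tau>_def by blast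
  moreover have sub2: "is_subperm \<sigma> Z \<tau>"
    unfolding \<tau>_def by (rule is_subperm_subperm[OF _ Zsub]) (use \<sigma>P P(1) in auto)
  moreover have "snd \<tau> i < snd \<tau> j" if "i \<in> {1..n}" "j \<in> {1..n}" "w i < w j" for i j
  proof -
    have "snd \<sigma> (z i) < snd \<sigma> (z j)"
      using sub z[OF that(1)] z[OF that(2)] w[OF that] unfolding is_subperm_def by metis
    then show ?thesis
      using sub2 that cZ nth_elem_image[OF zmono that(1)] nth_elem_image[OF zmono that(2)]
      unfolding is_subperm_def Z_def by metis
  qed
  moreover have "\<tau> = (n, snd \<tau>)" using sub2 cZ by (simp add: is_subperm_def prod_eq_iff)
  ultimately show ?thesis unfolding realizes_def by metis
qed

section \<open>Random subsets hit dense sets\<close>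

text \<open>This is \<open>(n choose M) / (N choose M) \<le> (n / N) ^ M\<close> cleared of
  denominators; the new factor in the induction is \<open>(n - M) / (N - M)\<close>, at most
  \<open>n / N\<close>. The cleared form also covers \<open>M > N\<close>, where both sides
  vanish.\<close>

lemma binomial_mult_power_le:
  assumes "n \<le> N"
  shows "(n choose M) * N ^ M \<le> (N choose M) * n ^ M"
proof (induction M)
  case (Suc M)
  have step: "Suc M * (k choose Suc M) = (k choose M) * (k - M)" for k
  proof (cases k)
    case (Suc m)
    then show ?thesis
      using binomial_absorb_comp[of k M] Suc_times_binomial_eq[of m M]
      by (simp only: diff_Suc_1 mult.commute)
  qed simp
  have "(n - M) * N \<le> (N - M) * n"
    using assms mult_le_mono2[OF assms, of M]
    by (simp add: diff_mult_distrib mult.commute[of N n] diff_le_mono2)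
  then have "((n choose M) * N ^ M) * ((n - M) * N) \<le> ((N choose M) * n ^ M) * ((N - M) * n)"
    by (rule mult_le_mono[OF Suc.IH])
  then have "(Suc M * (n choose Suc M)) * N ^ Suc M \<le> (Suc M * (N choose Suc M)) * n ^ Suc M"
    unfolding step by (simp add: mult_ac)
  then have "Suc M * ((n choose Suc M) * N ^ Suc M) \<le> Suc M * ((N choose Suc M) * n ^ Suc M)"
    by (simp only: mult.assoc)
  then show ?case by (simp only: mult_le_cancel1)
qed simp

text \<open>A set that misses \<open>A\<close> is chosen from the complement, which has at most
  \<open>(1 - a) * N\<close> elements.\<close>

lemma card_missing_le:
  assumes A: "A \<subseteq> {1..N}" "real (card A) \<ge> a * real N" and N: "N > 0" and a: "a \<le> 1"
  shows "real (card {X. X \<subseteq> {1..N} \<and> card X = M \<and> X \<inter> A = {}}) \<le> (1 - a) ^ M * real (N choose M)"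
proof -
  have fA: "finite A" using A finite_subset by blast
  define n where "n = N - card A"
  have cA: "card A \<le> N" using card_mono[OF _ A(1)] by simp
  have "{X. X \<subseteq> {1..N} \<and> card X = M \<and> X \<inter> A = {}} = {X. X \<subseteq> {1..N} - A \<and> card X = M}" by blast
  then have "card {X. X \<subseteq> {1..N} \<and> card X = M \<and> X \<inter> A = {}} = (card ({1..N} - A) choose M)"
    by (simp add: n_subsets)
  also have "card ({1..N} - A) = n" using A(1) fA by (simp add: card_Diff_subset n_def)
  finally have eq: "card {X. X \<subseteq> {1..N} \<and> card X = M \<and> X \<inter> A = {}} = (n choose M)" .
  have nle: "real n \<le> (1 - a) * real N"
    using A(2) cA by (simp add: n_def of_nat_diff algebra_simps)
  have "(n choose M) * N ^ M \<le> (N choose M) * n ^ M"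
    by (rule binomial_mult_power_le) (simp add: n_def)
  then have "real (n choose M) * real N ^ M \<le> real (N choose M) * real n ^ M"
    by (metis of_nat_le_iff of_nat_mult of_nat_power)
  also have "\<dots> \<le> real (N choose M) * ((1 - a) * real N) ^ M"
    using nle by (intro mult_left_mono power_mono) auto
  finally have "real (n choose M) * real N ^ M \<le> ((1 - a) ^ M * real (N choose M)) * real N ^ M"
    by (simp add: power_mult_distrib mult_ac)
  then show ?thesis unfolding eq using N by simp
qed

text \<open>Union bound: at most a fraction \<open>e\<close> of the \<open>M\<close>-subsets miss
  some \<open>A\<close>, while more than a fraction \<open>e\<close> induce a member of
  \<open>P\<close>, so one of the latter misses no \<open>A\<close>.\<close>

lemma hitting_subset:
  assumes \<pi>: "perm_order \<pi> = N" and M: "M \<le> N" "N > 0"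
    and pr: "measure_pmf.prob (random_subperm M \<pi>) P > e"
    and fin: "finite \<A>"
    and \<A>: "\<And>A. A \<in> \<A> \<Longrightarrow> A \<subseteq> {1..N} \<and> real (card A) \<ge> a * real N" and a: "a \<le> 1"
    and e: "real (card \<A>) * (1 - a) ^ M \<le> e"
  obtains X where "X \<subseteq> {1..N}" "subperm \<pi> X \<in> P" "\<And>A. A \<in> \<A> \<Longrightarrow> X \<inter> A \<noteq> {}"
proof -
  define \<Omega> where "\<Omega> = {X. X \<subseteq> {1..N} \<and> card X = M}"
  define miss where "miss A = {X. X \<subseteq> {1..N} \<and> card X = M \<and> X \<inter> A = {}}" for A
  define good where "good = \<Omega> \<inter> {X. subperm \<pi> X \<in> P}"
  have fO: "finite \<Omega>" unfolding \<Omega>_def by (rule finite_subset[of _ "Pow {1..N}"]) auto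
  have cO: "card \<Omega> = (N choose M)" unfolding \<Omega>_def by (simp add: n_subsets)
  have posO: "card \<Omega> > 0" using M by (simp add: cO)
  then have neO: "\<Omega> \<noteq> {}" by auto
  have "measure_pmf.prob (random_subperm M \<pi>) P = real (card good) / real (card \<Omega>)"
    unfolding random_subperm_def \<pi> \<Omega>_def[symmetric] good_def
    by (simp add: measure_pmf_of_set[OF neO fO] vimage_def)
  with pr posO have g: "e * real (card \<Omega>) < real (card good)" by (simp add: field_simps)
  have "real (card (\<Union>A\<in>\<A>. miss A)) \<le> real (\<Sum>A\<in>\<A>. card (miss A))"
    using card_UN_le[OF fin] by (metis of_nat_mono)
  also have "\<dots> \<le> (\<Sum>A\<in>\<A>. (1 - a) ^ M * real (card \<Omega>))"
    unfolding of_nat_sum cO miss_def using \<A> M(2) a by (intro sum_mono card_missing_le) auto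
  also have "\<dots> = (real (card \<A>) * (1 - a) ^ M) * real (card \<Omega>)" by simp
  also have "\<dots> \<le> e * real (card \<Omega>)" using e by (intro mult_right_mono) auto
  finally have lt: "card (\<Union>A\<in>\<A>. miss A) < card good" using g by linarith
  have "finite (\<Union>A\<in>\<A>. miss A)" 
    by (rule finite_subset[OF _ fO]) (auto simp: miss_def \<Omega>_def)
  then have "\<not> good \<subseteq> (\<Union>A\<in>\<A>. miss A)" using lt card_mono by (metis leD)
  then obtain X where "X \<in> good" "X \<notin> (\<Union>A\<in>\<A>. miss A)" by blast
  then show ?thesis by (intro that[of X]) (auto simp: good_def \<Omega>_def miss_def)
qed

section \<open>A scale at which the cells are homogeneous\<close>

text \<open>\<open>L j\<close> is the number of cells at level \<open>j\<close>; divisibility makes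
  later levels refine earlier ones. \<open>\<rho>\<close> is the density threshold for a colour in a
  cell.\<close>

locale coloured_positions =
  fixes N K :: nat and c :: "nat \<Rightarrow> nat" and L :: "nat \<Rightarrow> nat" and \<rho> :: real
  assumes c_less: "x \<in> {1..N} \<Longrightarrow> c x < K"
    and L_pos: "L j > 0"
    and L_dvd: "i \<le> j \<Longrightarrow> L i dvd L j"
    and \<rho>_nonneg: "\<rho> \<ge> 0"
begin

definition members :: "nat \<Rightarrow> nat \<Rightarrow> nat \<Rightarrow> nat set" where
  "members j h k = {x \<in> {1..N}. cell N (L j) x = h \<and> c x = k}"

text \<open>The threshold is the fraction \<open>\<rho>\<close> of the average cell size
  \<open>N / L j\<close>.\<close>

definition dense :: "nat \<Rightarrow> nat \<Rightarrow> nat \<Rightarrow> bool" where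
  "dense j h k \<longleftrightarrow> \<rho> * real N / real (L j) \<le> real (card (members j h k))"

text \<open>Asking for density at all levels up to \<open>j\<close> makes these sets decrease with
  \<open>j\<close>.\<close>

definition dense_colours :: "nat \<Rightarrow> nat \<Rightarrow> nat set" where
  "dense_colours j x = {k. k < K \<and> (\<forall>i \<le> j. dense i (cell N (L i) x) k)}"

text \<open>Both colour sets depend only on the cell of \<open>x\<close> at level
  \<open>Suc j\<close>, so one witness speaks for the whole child.\<close>

definition stable_children :: "nat \<Rightarrow> nat \<Rightarrow> nat set" where
  "stable_children j h = {g. \<exists>x \<in> {1..N}. cell N (L (Suc j)) x = g \<and> cell N (L j) x = h \<and>
     dense_colours (Suc j) x = dense_colours j x}"

text \<open>
  Cells with too few stable children get no colours; their positions are recoloured by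
  \<open>mono_retraction\<close>, which copies colour and cell from a neighbouring good position.
\<close>

definition pattern :: "nat \<Rightarrow> nat \<Rightarrow> nat \<Rightarrow> nat set" where
  "pattern j n h = (if n \<le> card (stable_children j h)
     then {k. \<exists>x \<in> {1..N}. cell N (L j) x = h \<and> k \<in> dense_colours j x} else {})"

lemma cell_coarsen: "i \<le> j \<Longrightarrow> cell N (L j) x = cell N (L j) y \<Longrightarrow> cell N (L i) x = cell N (L i) y"
  using cell_eq_dvd[OF L_dvd L_pos] by blast

lemma dense_colours_cong:
  "cell N (L j) x = cell N (L j) y \<Longrightarrow> dense_colours j x = dense_colours j y"
  using cell_coarsen[of _ j x y] by (auto simp: dense_colours_def)

lemma dense_colours_Suc: "dense_colours (Suc j) x \<subseteq> dense_colours j x"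
  by (auto simp: dense_colours_def)

lemma dense_colours_le: "dense_colours j x \<subseteq> {..<K}"
  by (auto simp: dense_colours_def)

lemma finite_dense_colours: "finite (dense_colours j x)"
  using dense_colours_le finite_subset by blast

lemma finite_stable_children: "finite (stable_children j h)"
  by (rule finite_subset[of _ "cell N (L (Suc j)) ` {1..N}"]) (auto simp: stable_children_def)

lemma stable_children_less: "g \<in> stable_children j h \<Longrightarrow> g < L (Suc j)"
  using cell_less[OF L_pos] by (auto simp: stable_children_def)

lemma pattern_subset: "pattern j n h \<subseteq> {..<K}"
  by (auto simp: pattern_def dense_colours_def)

text \<open>All positions of the cell \<open>h\<close> share the same dense colours at level
  \<open>j\<close>, and a stable child loses none of them at level \<open>Suc j\<close>.\<close>

lemma dense_stable_child:
  assumes "g \<in> stable_children j h" "k \<in> pattern j n h"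
  shows "dense (Suc j) g k"
proof -
  obtain x where x: "cell N (L (Suc j)) x = g" "cell N (L j) x = h"
      "dense_colours (Suc j) x = dense_colours j x"
    using assms(1) by (auto simp: stable_children_def)
  obtain y where "cell N (L j) y = h" "k \<in> dense_colours j y"
    using assms(2) by (auto simp: pattern_def split: if_splits)
  then have "k \<in> dense_colours (Suc j) x" using x dense_colours_cong[of j x y] by auto
  then show ?thesis using x by (auto simp: dense_colours_def)
qed

section \<open>Counting positions whose own colour is not allowed\<close>

text \<open>There are \<open>L i * K\<close> pairs of a cell and a colour, and each pair that is not
  dense accounts for at most \<open>\<rho> * N / L i\<close> positions.\<close>

lemma card_not_dense_at:
  "real (card {x \<in> {1..N}. \<not> dense i (cell N (L i) x) (c x)}) \<le> real K * \<rho> * real N"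
proof -
  define U where "U h k = (if dense i h k then {} else members i h k)" for h k
  have U: "real (card (U h k)) \<le> \<rho> * real N / real (L i)" for h k
    using \<rho>_nonneg by (auto simp: U_def dense_def)
  have fU: "finite (U h k)" for h k by (simp add: U_def members_def)
  have "{x \<in> {1..N}. \<not> dense i (cell N (L i) x) (c x)} \<subseteq> (\<Union>(h, k) \<in> {..<L i} \<times> {..<K}. U h k)"
    using cell_less[OF L_pos] c_less by (auto simp: U_def members_def intro!: bexI)
  then have "card {x \<in> {1..N}. \<not> dense i (cell N (L i) x) (c x)}
      \<le> card (\<Union>(h, k) \<in> {..<L i} \<times> {..<K}. U h k)"
    using fU by (intro card_mono) auto
  also have "\<dots> \<le> (\<Sum>(h, k) \<in> {..<L i} \<times> {..<K}. card (U h k))"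
    using card_UN_le[of "{..<L i} \<times> {..<K}" "\<lambda>(h, k). U h k"] by (simp add: case_prod_unfold)
  finally have "real (card {x \<in> {1..N}. \<not> dense i (cell N (L i) x) (c x)})
      \<le> (\<Sum>(h, k) \<in> {..<L i} \<times> {..<K}. real (card (U h k)))"
    by (simp add: case_prod_unfold flip: of_nat_sum)
  also have "\<dots> \<le> (\<Sum>(h, k) \<in> {..<L i} \<times> {..<K}. \<rho> * real N / real (L i))"
    using U by (intro sum_mono) auto
  also have "\<dots> = real K * \<rho> * real N" using L_pos[of i] by simp
  finally show ?thesis .
qed

lemma card_not_dense:
  "real (card {x \<in> {1..N}. c x \<notin> dense_colours j x}) \<le> real (Suc j) * (real K * \<rho> * real N)"
proof -
  have "{x \<in> {1..N}. c x \<notin> dense_colours j x}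
      = (\<Union>i \<in> {..j}. {x \<in> {1..N}. \<not> dense i (cell N (L i) x) (c x)})"
    using c_less by (auto simp: dense_colours_def)
  then have "card {x \<in> {1..N}. c x \<notin> dense_colours j x}
      \<le> (\<Sum>i \<in> {..j}. card {x \<in> {1..N}. \<not> dense i (cell N (L i) x) (c x)})"
    using card_UN_le[of "{..j}"] by simp
  then have "real (card {x \<in> {1..N}. c x \<notin> dense_colours j x})
      \<le> (\<Sum>i \<in> {..j}. real (card {x \<in> {1..N}. \<not> dense i (cell N (L i) x) (c x)}))"
    by (simp flip: of_nat_sum)
  also have "\<dots> \<le> (\<Sum>i \<in> {..j}. real K * \<rho> * real N)" by (intro sum_mono card_not_dense_at)
  finally show ?thesis by simp
qed

text \<open>At a fixed position the colour sets decrease and start with at most \<open>K\<close>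
  elements, so they change at most \<open>K\<close> times. Summed over all positions, the
  \<open>J\<close> levels see at most \<open>K * N\<close> changes, and the best level is no worse
  than the average.\<close>

lemma ex_stable_level:
  assumes "J > 0"
  obtains j where "j < J"
    "J * card {x \<in> {1..N}. dense_colours (Suc j) x \<noteq> dense_colours j x} \<le> K * N"
proof -
  let ?D = "\<lambda>j. {x \<in> {1..N}. dense_colours (Suc j) x \<noteq> dense_colours j x}"
  \<comment> \<open>Each change removes at least one colour, so the changes so far plus the colours
    left never exceed the initial number.\<close>
  have drops: "(\<Sum>j<J. if dense_colours (Suc j) x \<noteq> dense_colours j x then 1 else 0)
      + card (dense_colours J x) \<le> card (dense_colours 0 x)" for x
  proof (induction J)
    case (Suc J)
    have "(if dense_colours (Suc J) x \<noteq> dense_colours J x then 1 else 0)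
        + card (dense_colours (Suc J) x) \<le> card (dense_colours J x)"
    proof (cases "dense_colours (Suc J) x = dense_colours J x")
      case False
      then have "dense_colours (Suc J) x \<subset> dense_colours J x" using dense_colours_Suc by blast
      then show ?thesis using psubset_card_mono[OF finite_dense_colours, of "dense_colours (Suc J) x" J x]
        by simp
    qed simp
    then show ?case using Suc by simp
  qed simp
  have le: "(\<Sum>j<J. if dense_colours (Suc j) x \<noteq> dense_colours j x then 1 else 0) \<le> K" for x
    using drops[of x] card_mono[OF _ dense_colours_le, of 0 x] by simp
  have "(\<Sum>j<J. card (?D j))
      = (\<Sum>j<J. \<Sum>x\<in>{1..N}. if dense_colours (Suc j) x \<noteq> dense_colours j x then 1 else 0)"
    by (intro sum.cong) (auto simp: sum.If_cases Int_def)
  also have "\<dots> = (\<Sum>x\<in>{1..N}. \<Sum>j<J. if dense_colours (Suc j) x \<noteq> dense_colours j x then 1 else 0)"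
    by (rule sum.swap)
  also have "\<dots> \<le> (\<Sum>x\<in>{1..N}. K)" by (intro sum_mono le)
  finally have total: "(\<Sum>j<J. card (?D j)) \<le> K * N" by (simp add: mult.commute)
  define j where "j = arg_min_on (\<lambda>j. card (?D j)) {..<J}"
  have j: "j < J" "\<And>i. i < J \<Longrightarrow> card (?D j) \<le> card (?D i)"
    using arg_min_if_finite(1)[of "{..<J}" "\<lambda>j. card (?D j)"]
      arg_min_least[of "{..<J}" _ "\<lambda>j. card (?D j)"] assms unfolding j_def by auto
  have "J * card (?D j) = (\<Sum>i<J. card (?D j))" by simp
  also have "\<dots> \<le> (\<Sum>i<J. card (?D i))" using j(2) by (intro sum_mono) auto
  finally show ?thesis using that[OF j(1)] total by linarith
qed

text \<open>A position counted here witnesses that its own child cell is stable. So at most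
  \<open>L j\<close> cells contribute, each through fewer than \<open>n\<close> children of bounded
  size.\<close>

lemma card_few_stable_children:
  "card {x \<in> {1..N}. dense_colours (Suc j) x = dense_colours j x \<and>
       card (stable_children j (cell N (L j) x)) < n}
     \<le> L j * (n * (Suc N div L (Suc j) + 1))" (is "card ?A \<le> _")
proof -
  define H where "H = {h. h < L j \<and> card (stable_children j h) < n}"
  define C where "C g = {x \<in> {1..N}. cell N (L (Suc j)) x = g}" for g
  have H: "finite H" "card H \<le> L j"
    using card_mono[of "{..<L j}" H] by (auto simp: H_def)
  have "?A \<subseteq> (\<Union>h\<in>H. \<Union>g\<in>stable_children j h. C g)"
    using cell_less[OF L_pos[of j]] by (fastforce simp: H_def C_def stable_children_def)
  then have "card ?A \<le> card (\<Union>h\<in>H. \<Union>g\<in>stable_children j h. C g)"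
    using H finite_stable_children by (intro card_mono) (auto simp: C_def)
  also have "\<dots> \<le> (\<Sum>h\<in>H. card (\<Union>g\<in>stable_children j h. C g))"
    by (rule card_UN_le[OF H(1)])
  also have "\<dots> \<le> (\<Sum>h\<in>H. n * (Suc N div L (Suc j) + 1))"
  proof (rule sum_mono)
    fix h assume h: "h \<in> H"
    have "card (\<Union>g\<in>stable_children j h. C g) \<le> (\<Sum>g\<in>stable_children j h. card (C g))"
      by (rule card_UN_le[OF finite_stable_children])
    also have "\<dots> \<le> (\<Sum>g\<in>stable_children j h. Suc N div L (Suc j) + 1)"
      unfolding C_def by (intro sum_mono card_cell_le L_pos)
    also have "\<dots> \<le> n * (Suc N div L (Suc j) + 1)"
      unfolding sum_constant of_nat_id by (rule mult_le_mono1) (use h in \<open>auto simp: H_def\<close>)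
    finally show "card (\<Union>g\<in>stable_children j h. C g) \<le> n * (Suc N div L (Suc j) + 1)" .
  qed
  also have "\<dots> \<le> L j * (n * (Suc N div L (Suc j) + 1))"
    unfolding sum_constant of_nat_id by (rule mult_le_mono1[OF H(2)])
  finally show ?thesis .
qed

text \<open>A colour is missing only if it is not dense at some level up to \<open>j\<close>, or the
  dense colours change after level \<open>j\<close>, or the cell has fewer than \<open>n\<close>
  stable children. The three terms bound these cases.\<close>

lemma card_not_pattern:
  "real (card ({1..N} - {x \<in> {1..N}. c x \<in> pattern j n (cell N (L j) x)}))
    \<le> real (Suc j) * (real K * \<rho> * real N)
      + real (card {x \<in> {1..N}. dense_colours (Suc j) x \<noteq> dense_colours j x})
      + real (L j * (n * (Suc N div L (Suc j) + 1)))"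
proof -
  define A where "A = {x \<in> {1..N}. c x \<notin> dense_colours j x}"
  define B where "B = {x \<in> {1..N}. dense_colours (Suc j) x \<noteq> dense_colours j x}"
  define C where "C = {x \<in> {1..N}. dense_colours (Suc j) x = dense_colours j x \<and>
       card (stable_children j (cell N (L j) x)) < n}"
  have "{1..N} - {x \<in> {1..N}. c x \<in> pattern j n (cell N (L j) x)} \<subseteq> (A \<union> B) \<union> C"
  proof
    fix x assume x: "x \<in> {1..N} - {x \<in> {1..N}. c x \<in> pattern j n (cell N (L j) x)}"
    show "x \<in> (A \<union> B) \<union> C"
    proof (rule ccontr)
      assume "x \<notin> (A \<union> B) \<union> C"
      then have "c x \<in> dense_colours j x" "n \<le> card (stable_children j (cell N (L j) x))"
        using x by (auto simp: A_def B_def C_def)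
      then show False using x by (auto simp: pattern_def)
    qed
  qed
  then have "card ({1..N} - {x \<in> {1..N}. c x \<in> pattern j n (cell N (L j) x)}) \<le> card ((A \<union> B) \<union> C)"
    by (rule card_mono[rotated]) (auto simp: A_def B_def C_def)
  also have "\<dots> \<le> card A + card B + card C"
    by (intro order_trans[OF card_Un_le] add_mono card_Un_le order_refl)
  finally have "real (card ({1..N} - {x \<in> {1..N}. c x \<in> pattern j n (cell N (L j) x)}))
      \<le> real (card A) + real (card B) + real (card C)" by (simp flip: of_nat_add)
  moreover have "real (card A) \<le> real (Suc j) * (real K * \<rho> * real N)"
    unfolding A_def by (rule card_not_dense)
  moreover have "real (card C) \<le> real (L j * (n * (Suc N div L (Suc j) + 1)))"
    unfolding C_def of_nat_le_iff by (rule card_few_stable_children)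
  ultimately show ?thesis unfolding B_def by linarith
qed

text \<open>The \<open>i\<close>-th letter is sought in the \<open>i\<close>-th stable child of its
  cell, which exists because a nonempty pattern guarantees \<open>n\<close> stable children. Letters
  in one cell then use increasing children, and letters in different cells are ordered by the
  cells.\<close>

lemma fits_occurs:
  assumes hit: "\<And>g k. g < L (Suc j) \<Longrightarrow> k < K \<Longrightarrow> dense (Suc j) g k \<Longrightarrow> X \<inter> members (Suc j) g k \<noteq> {}"
    and fit: "fits (L j) (pattern j n) n' b w" and n': "n' \<le> n"
  obtains y where "strict_mono_on {1..n'} y" "y ` {1..n'} \<subseteq> X" "\<And>i. i \<in> {1..n'} \<Longrightarrow> c (y i) = w i"
proof -
  define g where "g i = nth_elem (stable_children j (b i)) i" for i
  have pat: "w i \<in> pattern j n (b i)" if "i \<in> {1..n'}" for i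
    using fit that by (auto simp: fits_def)
  then have ch: "n \<le> card (stable_children j (b i))" if "i \<in> {1..n'}" for i
    using that by (fastforce simp: pattern_def split: if_splits)
  have g: "g i \<in> stable_children j (b i)" if "i \<in> {1..n'}" for i
    unfolding g_def using ch[OF that] n' that by (intro nth_elem_in finite_stable_children) auto
  have "\<exists>x. x \<in> X \<inter> members (Suc j) (g i) (w i)" if "i \<in> {1..n'}" for i
    using hit[OF stable_children_less[OF g[OF that]] _ dense_stable_child[OF g[OF that] pat[OF that]]]
      pat[OF that] pattern_subset by fastforce
  then obtain y where y: "\<And>i. i \<in> {1..n'} \<Longrightarrow> y i \<in> X \<inter> members (Suc j) (g i) (w i)" by metis
  have cy: "cell N (L (Suc j)) (y i) = g i" "cell N (L j) (y i) = b i" if "i \<in> {1..n'}" for i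
  proof -
    show 1: "cell N (L (Suc j)) (y i) = g i" using y[OF that] by (simp add: members_def)
    note gi = g[OF that]
    obtain x where x: "cell N (L (Suc j)) x = g i" "cell N (L j) x = b i"
      using gi unfolding stable_children_def by blast
    show "cell N (L j) (y i) = b i"
      using cell_coarsen[of j "Suc j" "y i" x] 1 x by simp
  qed
  have "strict_mono_on {1..n'} y"
  proof (rule strict_mono_onI)
    fix i i' assume i: "i \<in> {1..n'}" "i' \<in> {1..n'}" "i < i'"
    have "b i \<le> b i'" using fit i by (auto simp: fits_def mono_on_def)
    then consider "b i < b i'" | "b i = b i'" by linarith
    then show "y i < y i'"
    proof cases
      case 1
      then show ?thesis using less_if_cell_less[of N "L j"] cy i by simp
    next
      case 2
      have "g i < g i'" unfolding g_def 2
        using i ch[OF i(2)] n' by (intro nth_elem_strict_mono finite_stable_children) auto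
      then show ?thesis using less_if_cell_less[of N "L (Suc j)"] cy i by simp
    qed
  qed
  then show ?thesis using y by (intro that[of y]) (auto simp: members_def)
qed

end

section \<open>Kendall's tau distance to a recoloured word\<close>

text \<open>Each \<open>i\<close> goes to the largest element of \<open>G\<close> up to
  \<open>i\<close>, or to \<open>Min G\<close> if there is none. Monotonicity keeps the cells in
  order when bad positions copy good ones.\<close>

lemma mono_retraction:
  fixes G :: "nat set"
  assumes "finite G" "G \<noteq> {}"
  obtains g where "mono g" "\<And>i. g i \<in> G" "\<And>i. i \<in> G \<Longrightarrow> g i = i"
proof
  define g where "g i = (if i < Min G then Min G else Max (G \<inter> {..i}))" for i
  have ne: "G \<inter> {..i} \<noteq> {}" if "\<not> i < Min G" for i
    using Min_in[OF assms] that by (auto simp: not_less)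
  have gle: "g i = Max (G \<inter> {..i})" "g i \<in> G \<inter> {..i}" if "\<not> i < Min G" for i
    using Max_in[OF _ ne[OF that]] assms that by (auto simp: g_def)
  show G: "g i \<in> G" for i
    using gle[of i] Min_in[OF assms] by (cases "i < Min G") (auto simp: g_def)
  show "g i = i" if "i \<in> G" for i
    using that assms by (auto simp: g_def intro!: Max_eqI)
  show "mono g"
  proof (rule monoI)
    fix i j :: nat assume ij: "i \<le> j"
    show "g i \<le> g j"
    proof (cases "i < Min G")
      case True
      then have "g i = Min G" by (simp add: g_def)
      then show ?thesis using G[of j] assms by simp
    next
      case False
      then have "\<not> j < Min G" using ij by linarith
      then have "g i \<in> G \<inter> {..j}" "g j = Max (G \<inter> {..j})" using gle[of i] gle[of j] False ij by auto
      then show ?thesis using assms by simp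
    qed
  qed
qed

text \<open>If \<open>i\<close> and \<open>j\<close> are in \<open>G\<close> and
  \<open>p i < p j\<close> lie in different strips, then \<open>w i < w j\<close>, so
  \<open>s\<close> agrees with \<open>p\<close>. A counted pair thus has a coordinate outside
  \<open>G\<close> or both values in one strip.\<close>

lemma card_inversions_le:
  fixes s w :: "nat \<Rightarrow> nat"
  assumes p: "p permutes {1..N}" and K: "K > 0" and G: "G \<subseteq> {1..N}"
    and w: "\<And>i. i \<in> G \<Longrightarrow> w i = cell N K (p i)"
    and s: "\<And>i j. i \<in> {1..N} \<Longrightarrow> j \<in> {1..N} \<Longrightarrow> w i < w j \<Longrightarrow> s i < s j"
  shows "card {(i, j) \<in> {1..N} \<times> {1..N}. p i < p j \<and> s i > s j}
    \<le> 2 * (card ({1..N} - G) * N) + N * (Suc N div K + 1)"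
proof -
  let ?B = "{1..N} - G"
  define C where "C i = {j \<in> {1..N}. cell N K (p j) = cell N K (p i)}" for i
  have C: "card (C i) \<le> Suc N div K + 1" for i
  proof -
    have "card (C i) = card (p ` C i)"
      using p by (metis card_image permutes_inj_on)
    also have "\<dots> \<le> card {v \<in> {1..N}. cell N K v = cell N K (p i)}"
      using permutes_image[OF p] by (intro card_mono) (auto simp: C_def)
    finally show ?thesis using card_cell_le[OF K, of N "cell N K (p i)"] by linarith
  qed
  have "{(i, j) \<in> {1..N} \<times> {1..N}. p i < p j \<and> s i > s j}
      \<subseteq> (?B \<times> {1..N} \<union> {1..N} \<times> ?B) \<union> (SIGMA i:{1..N}. C i)"
  proof
    fix x assume "x \<in> {(i, j) \<in> {1..N} \<times> {1..N}. p i < p j \<and> s i > s j}"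
    then obtain i j where x: "x = (i, j)" "i \<in> {1..N}" "j \<in> {1..N}" "p i < p j" "s j < s i"
      by auto
    show "x \<in> (?B \<times> {1..N} \<union> {1..N} \<times> ?B) \<union> (SIGMA i:{1..N}. C i)"
    proof (rule ccontr)
      assume "\<not> ?thesis"
      then have "i \<in> G" "j \<in> G" and ne: "cell N K (p i) \<noteq> cell N K (p j)"
        using x by (auto simp: C_def)
      moreover have "cell N K (p i) \<le> cell N K (p j)" using x(4) by (intro cell_mono) simp
      ultimately have "w i < w j" using w by simp
      then show False using s[OF x(2,3)] x(5) by linarith
    qed
  qed
  then have "card {(i, j) \<in> {1..N} \<times> {1..N}. p i < p j \<and> s i > s j}
      \<le> card ((?B \<times> {1..N} \<union> {1..N} \<times> ?B) \<union> (SIGMA i:{1..N}. C i))"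
    by (rule card_mono[rotated]) (auto simp: C_def)
  also have "\<dots> \<le> (card (?B \<times> {1..N}) + card ({1..N} \<times> ?B)) + card (SIGMA i:{1..N}. C i)"
    by (intro order_trans[OF card_Un_le] add_mono card_Un_le order_refl)
  also have "card (SIGMA i:{1..N}. C i) = (\<Sum>i\<in>{1..N}. card (C i))"
    by (rule card_SigmaI) (auto simp: C_def)
  also have "\<dots> \<le> (\<Sum>i\<in>{1..N}. Suc N div K + 1)" by (intro sum_mono C)
  finally show ?thesis by (simp add: card_cartesian_product mult.commute)
qed

text \<open>The word of \<open>p\<close> read along the retraction \<open>g\<close> onto
  \<open>G\<close> fits \<open>S\<close>, because both cell and letter are taken at the good
  position \<open>g i\<close>. It agrees with the word of \<open>p\<close> on \<open>G\<close>, so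
  any \<open>\<sigma>\<close> realising it is close to \<open>p\<close>.\<close>

lemma full_close:
  assumes p: "p permutes {1..N}" and K: "K > 0" and q: "q > 0"
    and G: "G \<subseteq> {1..N}" "G \<noteq> {}" "\<And>i. i \<in> G \<Longrightarrow> cell N K (p i) \<in> S (cell N q i)"
    and full: "full P q S"
  obtains \<sigma> where "\<sigma> \<in> P" "perm_order \<sigma> = N"
    "dist_K (N, p) \<sigma> * real (N choose 2)
       \<le> real (2 * (card ({1..N} - G) * N) + N * (Suc N div K + 1))"
proof -
  have fG: "finite G" using G(1) finite_subset by blast
  obtain g where g: "mono g" "\<And>i. g i \<in> G" "\<And>i. i \<in> G \<Longrightarrow> g i = i"
    using mono_retraction[OF fG G(2)] by blast
  have gN: "g i \<le> N" for i using g(2)[of i] G(1) by auto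
  have "N \<ge> 1" using G(1,2) by (cases N) auto
  moreover have "fits q S N (\<lambda>i. cell N q (g i)) (\<lambda>i. cell N K (p (g i)))"
    using g G cell_less[OF q gN] by (auto simp: fits_def mono_on_def monoD intro!: cell_mono)
  ultimately have "realizes P N (\<lambda>i. cell N K (p (g i)))" using full by (auto simp: full_def)
  then obtain s where s: "(N, s) \<in> P"
      "\<And>i j. i \<in> {1..N} \<Longrightarrow> j \<in> {1..N} \<Longrightarrow> cell N K (p (g i)) < cell N K (p (g j)) \<Longrightarrow> s i < s j"
    unfolding realizes_def by blast
  have card: "card {(i, j) \<in> {1..N} \<times> {1..N}. p i < p j \<and> s i > s j}
    \<le> 2 * (card ({1..N} - G) * N) + N * (Suc N div K + 1)"
    using g(3) by (intro card_inversions_le[OF p K G(1) _ s(2)]) auto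
  have "dist_K (N, p) (N, s) * real (N choose 2)
      \<le> real (card {(i, j) \<in> {1..N} \<times> {1..N}. p i < p j \<and> s i > s j})"
    by (simp add: dist_K_def)
  also have "\<dots> \<le> real (2 * (card ({1..N} - G) * N) + N * (Suc N div K + 1))"
    using card by (rule of_nat_mono)
  finally show ?thesis using s(1) by (intro that[of "(N, s)"]) auto
qed

section \<open>The tower of scales and the choice of constants\<close>

text \<open>
  The number of children of a cell has to be chosen after the number of cells, because the bound of
  \<open>full_bound\<close> depends on the latter.
\<close>

primrec scale :: "(nat \<Rightarrow> nat) \<Rightarrow> nat \<Rightarrow> nat" where
  "scale f 0 = 1"
| "scale f (Suc j) = scale f j * f (scale f j)"

lemma scale_pos: "(\<And>x. f x > 0) \<Longrightarrow> scale f j > 0"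
  by (induction j) auto

lemma scale_dvd: "i \<le> j \<Longrightarrow> scale f i dvd scale f j"
  by (induction rule: dec_induct) auto

text \<open>\<open>fits\<close> evaluates \<open>S\<close> only at cells below \<open>L\<close>.
  This reconciles \<open>pattern\<close>, defined everywhere, with the finite function space of
  \<open>full_bound\<close>.\<close>

lemma full_restrict: "full P L (restrict S {..<L}) \<longleftrightarrow> full P L S"
proof -
  have "fits L (restrict S {..<L}) n b w \<longleftrightarrow> fits L S n b w" for n b w
    by (auto simp: fits_def)
  then show ?thesis by (simp add: full_def)
qed

text \<open>Otherwise some unrealised word of length at most \<open>n\<close> fits the pattern. It
  occurs in \<open>X\<close>, and since colours are strips of values, heredity realises it after
  all.\<close>

lemma (in coloured_positions) full_pattern:
  assumes P: "P \<subseteq> nperms" "hereditary P"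
    and p: "(N, p) \<in> nperms" and c: "\<And>x. c x = cell N K (p x)"
    and X: "X \<subseteq> {1..N}" "subperm (N, p) X \<in> P"
    and hit: "\<And>g k. g < L (Suc j) \<Longrightarrow> k < K \<Longrightarrow> dense (Suc j) g k \<Longrightarrow> X \<inter> members (Suc j) g k \<noteq> {}"
    and n: "\<And>S. S \<in> {..<L j} \<rightarrow>\<^sub>E Pow {..<K} \<Longrightarrow> \<not> full P (L j) S \<Longrightarrow>
      \<exists>n' b w. n' \<in> {1..n} \<and> fits (L j) S n' b w \<and> \<not> realizes P n' w"
  shows "full P (L j) (pattern j n)"
proof (rule ccontr)
  assume nf: "\<not> full P (L j) (pattern j n)"
  have "restrict (pattern j n) {..<L j} \<in> {..<L j} \<rightarrow>\<^sub>E Pow {..<K}"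
    using pattern_subset by auto
  from n[OF this] nf obtain n' b w where n': "n' \<in> {1..n}"
      and fit: "fits (L j) (restrict (pattern j n) {..<L j}) n' b w" and nr: "\<not> realizes P n' w"
    by (auto simp: full_restrict)
  have fit': "fits (L j) (pattern j n) n' b w" using fit by (auto simp: fits_def)
  from n' have n'n: "n' \<le> n" by simp
  obtain y where y: "strict_mono_on {1..n'} y" "y ` {1..n'} \<subseteq> X"
      and cw: "\<And>i. i \<in> {1..n'} \<Longrightarrow> c (y i) = w i"
    using fits_occurs[OF hit fit' n'n] by blast
  have "realizes P n' w"
  proof (rule realizes_sub[OF P p _ X(2) _ y])
    show "X \<subseteq> {1..perm_order (N, p)}" "1 \<le> n'" using X n' by auto
    fix i i' assume i: "i \<in> {1..n'}" "i' \<in> {1..n'}" "w i < w i'"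
    then have "cell N K (p (y i)) < cell N K (p (y i'))" using cw c by metis
    then show "snd (N, p) (y i) < snd (N, p) (y i')" using less_if_cell_less by simp
  qed
  then show False using nr by simp
qed

theorem theorem6:
  fixes P :: "nperm set"
  assumes "P \<subseteq> nperms"
    and "hereditary P"
  shows "\<forall>\<epsilon>\<^sub>0::real. \<epsilon>\<^sub>0 > 0 \<longrightarrow>
    (\<exists>M\<^sub>0::nat. M\<^sub>0 > 0 \<and>
      (\<forall>\<pi> \<in> nperms.
         perm_order \<pi> \<ge> M\<^sub>0 \<and> dist_K_property \<pi> P \<ge> ereal \<epsilon>\<^sub>0 \<longrightarrow>
         measure_pmf.prob (random_subperm M\<^sub>0 \<pi>) P \<le> \<epsilon>\<^sub>0))"
proof (intro allI impI)
  fix \<epsilon> :: real assume \<epsilon>: "\<epsilon> > 0"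
  show "\<exists>M\<^sub>0::nat. M\<^sub>0 > 0 \<and>
      (\<forall>\<pi> \<in> nperms. perm_order \<pi> \<ge> M\<^sub>0 \<and> dist_K_property \<pi> P \<ge> ereal \<epsilon> \<longrightarrow>
         measure_pmf.prob (random_subperm M\<^sub>0 \<pi>) P \<le> \<epsilon>)"
  \<comment> \<open>For \<open>\<epsilon> > 1\<close> any sample size works, since a probability is
    at most 1.\<close>
  proof (cases "\<epsilon> \<le> 1")
    case False
    then show ?thesis
      using measure_pmf.prob_le_1 by (intro exI[of _ 1]) (auto intro: order_trans)
  next
    case True
    \<comment> \<open>The choice of \<open>K\<close> makes pairs within one strip cost less than
      \<open>\<epsilon> / 8 * N^2\<close>. Each of the three kinds of bad positions is granted
      \<open>\<epsilon> / 96 * N\<close>: \<open>J\<close> pays for changing colour sets,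
      \<open>Q\<close> for cells with few stable children, and \<open>\<rho>\<close> below for
      colours that are not dense.\<close>
    obtain K :: nat where K: "real K > 24 / \<epsilon>" using reals_Archimedean2 by blast
    obtain J :: nat where J: "real J > 96 * real K / \<epsilon>" using reals_Archimedean2 by blast
    obtain Q :: nat where Q: "real Q > 288 / \<epsilon>" using reals_Archimedean2 by blast
    have K0: "K > 0" using K \<epsilon> by (metis divide_pos_pos gr0I of_nat_0 order_less_asym zero_less_numeral)
    have J0: "J > 0" using J \<epsilon> by (cases J) (auto simp: field_simps not_less)
    have Q0: "Q > 0" using Q \<epsilon> by (cases Q) (auto simp: field_simps not_less)
    define \<rho> where "\<rho> = \<epsilon> / (96 * real J * real K)"
    have \<rho>: "\<rho> > 0" using \<epsilon> J0 K0 by (simp add: \<rho>_def)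
    have "1 * 1 \<le> real J * real K" using J0 K0 by (intro mult_mono) auto
    then have \<rho>1: "\<rho> \<le> 1" using True J0 K0 by (simp add: \<rho>_def field_simps)
    have "\<exists>nb. \<forall>q. nb q \<ge> (1::nat) \<and> (\<forall>S \<in> {..<q} \<rightarrow>\<^sub>E Pow {..<K}. \<not> full P q S \<longrightarrow>
        (\<exists>n' b w. n' \<in> {1..nb q} \<and> fits q S n' b w \<and> \<not> realizes P n' w))"
      using full_bound[of _ K P] by (intro choice) blast
    then obtain nb where nb1: "\<And>q. nb q \<ge> (1::nat)" and
      nb: "\<And>q S. S \<in> {..<q} \<rightarrow>\<^sub>E Pow {..<K} \<Longrightarrow> \<not> full P q S \<Longrightarrow>
        \<exists>n' b w. n' \<in> {1..nb q} \<and> fits q S n' b w \<and> \<not> realizes P n' w"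
      by blast
    \<comment> \<open>A cell has \<open>nb q * Q\<close> children, so \<open>nb q\<close> of them
      are only a fraction \<open>1 / Q\<close>.\<close>
    define L where "L = scale (\<lambda>q. nb q * Q)"
    have Lpos: "L j > 0" for j
      unfolding L_def by (rule scale_pos) (use nb1 Q0 in \<open>simp add: Suc_le_eq\<close>)
    have Ldvd: "L i dvd L j" if "i \<le> j" for i j unfolding L_def using that by (rule scale_dvd)
    have Lle: "L i \<le> L j" if "i \<le> j" for i j using Ldvd[OF that] Lpos[of j] by (rule dvd_imp_le)
    \<comment> \<open>The threshold at the finest level bounds those of all levels up to
      \<open>J\<close> from below, so \<open>M\<close> can be chosen before the stable level
      \<open>j\<close>, which depends on \<open>\<pi>\<close>.\<close>
    define a where "a = \<rho> / real (L J)"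
    have "1 \<le> real (L J)" using Lpos[of J] by simp
    then have a: "0 < a" "a \<le> 1" using \<rho> \<rho>1 by (auto simp: a_def field_simps)
    have "(\<lambda>M. real (L J * K) * (1 - a) ^ M) \<longlonglongrightarrow> real (L J * K) * 0"
      using a by (intro tendsto_mult tendsto_const LIMSEQ_realpow_zero) auto
    then have "\<forall>\<^sub>F M in sequentially. real (L J * K) * (1 - a) ^ M < \<epsilon>"
      using \<epsilon> by (intro order_tendstoD(2)) auto
    \<comment> \<open>The bounds by \<open>L J\<close> and \<open>K\<close> keep the rounding error
      in the size of cells and strips harmless; \<open>M \<ge> 2\<close> makes
      \<open>N choose 2\<close> positive.\<close>
    then have "\<forall>\<^sub>F M in sequentially. real (L J * K) * (1 - a) ^ M < \<epsilon> \<and> M \<ge> L J \<and> M \<ge> K \<and> M \<ge> 2"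
      by (intro eventually_conj eventually_ge_at_top)
    then obtain M where M: "real (L J * K) * (1 - a) ^ M < \<epsilon>" "M \<ge> L J" "M \<ge> K" "M \<ge> 2"
      by (auto simp: eventually_sequentially)
    show ?thesis
    proof (intro exI[of _ M] conjI ballI impI)
      show "M > 0" using M by simp
      fix \<pi> :: nperm
      assume \<pi>: "\<pi> \<in> nperms" and "M \<le> perm_order \<pi> \<and> ereal \<epsilon> \<le> dist_K_property \<pi> P"
      moreover obtain N p where Np: "\<pi> = (N, p)" by (cases \<pi>)
      ultimately have NM: "M \<le> N" and dist: "ereal \<epsilon> \<le> dist_K_property \<pi> P" by auto
      have p: "p permutes {1..N}" using \<pi> Np by (simp add: nperms_def)
      show "measure_pmf.prob (random_subperm M \<pi>) P \<le> \<epsilon>"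
      proof (rule ccontr)
        assume "\<not> measure_pmf.prob (random_subperm M \<pi>) P \<le> \<epsilon>"
        then have pr: "measure_pmf.prob (random_subperm M \<pi>) P > \<epsilon>" by simp
        define c where "c x = cell N K (p x)" for x
        interpret coloured_positions N K c L \<rho>
        proof
          show "c x < K" if "x \<in> {1..N}" for x
            unfolding c_def using permutes_in_image[OF p, of x] that by (intro cell_less K0) auto
        qed (use Lpos Ldvd \<rho> in auto)
        obtain j where j: "j < J"
          and stable: "J * card {x \<in> {1..N}. dense_colours (Suc j) x \<noteq> dense_colours j x} \<le> K * N"
          using ex_stable_level[OF J0] by blast
        define n where "n = nb (L j)"
        define \<A> where "\<A> = (\<lambda>(g, k). members (Suc j) g k) `
            {(g, k) \<in> {..<L (Suc j)} \<times> {..<K}. dense (Suc j) g k}"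
        have fin: "finite {(g, k) \<in> {..<L (Suc j)} \<times> {..<K}. dense (Suc j) g k}"
          by (rule finite_subset[of _ "{..<L (Suc j)} \<times> {..<K}"]) auto
        have "card {(g, k) \<in> {..<L (Suc j)} \<times> {..<K}. dense (Suc j) g k}
            \<le> card ({..<L (Suc j)} \<times> {..<K})"
          by (rule card_mono) auto
        then have "card \<A> \<le> L (Suc j) * K"
          using card_image_le[OF fin] unfolding \<A>_def card_cartesian_product card_lessThan
          by (rule order_trans[rotated])
        also have "\<dots> \<le> L J * K" using Lle[of "Suc j" J] j by simp
        finally have cA: "real (card \<A>) * (1 - a) ^ M \<le> \<epsilon>"
          using M(1) a mult_right_mono[of "real (card \<A>)" "real (L J * K)" "(1 - a) ^ M"]
          by (simp del: of_nat_mult)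
        have dA: "A \<subseteq> {1..N} \<and> real (card A) \<ge> a * real N" if "A \<in> \<A>" for A
        proof -
          obtain g k where gk: "A = members (Suc j) g k" "dense (Suc j) g k"
            using \<open>A \<in> \<A>\<close> by (auto simp: \<A>_def)
          have "a * real N = \<rho> * real N / real (L J)" by (simp add: a_def)
          also have "\<dots> \<le> \<rho> * real N / real (L (Suc j))"
            using Lle[of "Suc j" J] j Lpos[of "Suc j"] \<rho> by (intro divide_left_mono mult_pos_pos) auto
          also have "\<dots> \<le> real (card A)" using gk by (simp add: dense_def)
          finally show ?thesis using gk by (auto simp: members_def)
        qed
        have N2: "N \<ge> 2" using NM M by simp
        have "perm_order \<pi> = N" "N > 0" "finite \<A>" using Np N2 fin by (auto simp: \<A>_def)
        then obtain X where X: "X \<subseteq> {1..N}" "subperm \<pi> X \<in> P" "\<And>A. A \<in> \<A> \<Longrightarrow> X \<inter> A \<noteq> {}"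
          using hitting_subset[OF _ NM _ pr _ dA a(2) cA] by blast
        have "full P (L j) (pattern j n)"
        proof (rule full_pattern[OF assms _ c_def X(1)])
          show "(N, p) \<in> nperms" "subperm (N, p) X \<in> P" using \<pi> X Np by auto
          show "X \<inter> members (Suc j) g k \<noteq> {}" if "g < L (Suc j)" "k < K" "dense (Suc j) g k" for g k
            using that by (intro X(3)) (auto simp: \<A>_def)
        qed (unfold n_def, rule nb)
        moreover define G where "G = {x \<in> {1..N}. c x \<in> pattern j n (cell N (L j) x)}"
        have bad: "real (card ({1..N} - G)) \<le> \<epsilon> / 32 * real N"
        proof -
          have "real (Suc j) * (real K * \<rho> * real N) \<le> real J * (real K * \<rho> * real N)"
            using j \<rho> by (intro mult_right_mono) auto
          also have "\<dots> = \<epsilon> / 96 * real N" using J0 K0 by (simp add: \<rho>_def)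
          finally have 1: "real (Suc j) * (real K * \<rho> * real N) \<le> \<epsilon> / 96 * real N" .
          let ?u = "real (card {x \<in> {1..N}. dense_colours (Suc j) x \<noteq> dense_colours j x})"
          have "real J * ?u \<le> real K * real N"
            using stable by (metis of_nat_le_iff of_nat_mult)
          also have "\<dots> \<le> (\<epsilon> * real J / 96) * real N"
            using J \<epsilon> by (intro mult_right_mono) (auto simp: field_simps)
          finally have "real J * ?u \<le> real J * (\<epsilon> / 96 * real N)" by (simp add: mult_ac)
          then have 2: "?u \<le> \<epsilon> / 96 * real N" using J0 by simp
          have LS: "L (Suc j) = L j * n * Q" by (simp add: L_def n_def)
          have LN: "L (Suc j) \<le> N" using Lle[of "Suc j" J] j M NM by linarith
          \<comment> \<open>\<open>L j * n\<close> is the fraction \<open>1 / Q\<close> of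
            \<open>L (Suc j)\<close>, and \<open>L (Suc j) \<le> N\<close> absorbs the rounding
            term.\<close>
          have "L j * (n * (Suc N div L (Suc j) + 1)) * Q = L (Suc j) * (Suc N div L (Suc j)) + L (Suc j)"
            by (simp add: LS algebra_simps)
          also have "\<dots> \<le> 3 * N" using times_div_less_eq_dividend[of "L (Suc j)" "Suc N"] LN N2 by linarith
          finally have "real (L j * (n * (Suc N div L (Suc j) + 1))) * real Q \<le> 3 * real N"
            by (metis of_nat_le_iff of_nat_mult of_nat_numeral)
          also have "\<dots> \<le> (\<epsilon> / 96 * real N) * real Q"
          proof -
            have "3 \<le> \<epsilon> / 96 * real Q" using Q \<epsilon> by (simp add: field_simps)
            then have "3 * real N \<le> (\<epsilon> / 96 * real Q) * real N" by (intro mult_right_mono) auto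
            then show ?thesis by (simp add: mult_ac)
          qed
          finally have 3: "real (L j * (n * (Suc N div L (Suc j) + 1))) \<le> \<epsilon> / 96 * real N"
            by (rule mult_right_le_imp_le) (use Q0 in simp)
          show ?thesis using card_not_pattern[of j n] 1 2 3 unfolding G_def by linarith
        qed
        have "G \<noteq> {}"
        proof
          assume "G = {}"
          then have "real N \<le> \<epsilon> / 32 * real N" using bad by simp
          then show False using True N2 by simp
        qed
        moreover have "G \<subseteq> {1..N}" "\<And>i. i \<in> G \<Longrightarrow> cell N K (p i) \<in> pattern j n (cell N (L j) i)"
          by (auto simp: G_def c_def)
        ultimately obtain \<sigma> where \<sigma>: "\<sigma> \<in> P" "perm_order \<sigma> = N" and
          d: "dist_K (N, p) \<sigma> * real (N choose 2)
            \<le> real (2 * (card ({1..N} - G) * N) + N * (Suc N div K + 1))"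
          using full_close[OF p K0 Lpos] by metis
        have choose: "real N * real N / 4 \<le> real (N choose 2)" "real (N choose 2) > 0"
        proof -
          have "real (N choose 2) = real N * (real N - 1) / 2"
            using N2 by (simp add: choose_two of_nat_diff real_of_nat_div)
          moreover have "real N * (real N / 2) \<le> real N * (real N - 1)"
            using N2 by (intro mult_left_mono) auto
          ultimately show "real N * real N / 4 \<le> real (N choose 2)" by simp
          show "real (N choose 2) > 0" using N2 by simp
        qed
        have "K * (Suc N div K + 1) \<le> 3 * N"
          using times_div_less_eq_dividend[of K "Suc N"] M(3) NM N2
          unfolding distrib_left by linarith
        then have "real K * real (Suc N div K + 1) \<le> 3 * real N"
          by (metis of_nat_le_iff of_nat_mult of_nat_numeral)
        also have "\<dots> < (\<epsilon> * real K / 8) * real N"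
          using K \<epsilon> N2 by (intro mult_strict_right_mono) (auto simp: field_simps)
        finally have "real K * real (Suc N div K + 1) < real K * (\<epsilon> / 8 * real N)"
          by (simp add: mult_ac)
        then have strip: "real (Suc N div K + 1) < \<epsilon> / 8 * real N"
          using K0 by (simp only: mult_less_cancel_left_pos of_nat_0_less_iff)
        have "dist_K (N, p) \<sigma> * real (N choose 2)
            \<le> 2 * real (card ({1..N} - G)) * real N + real N * real (Suc N div K + 1)"
          using d by (simp add: algebra_simps)
        also have "\<dots> < 2 * (\<epsilon> / 32 * real N) * real N + real N * (\<epsilon> / 8 * real N)"
          using bad strip N2 by (intro add_le_less_mono mult_right_mono mult_strict_left_mono) auto
        \<comment> \<open>The coefficients add up to \<open>3/16\<close>, below
          \<open>1/4\<close>.\<close>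
        also have "\<dots> \<le> \<epsilon> * (real N * real N / 4)" using \<epsilon> by simp
        also have "\<dots> \<le> \<epsilon> * real (N choose 2)" using choose \<epsilon> by (intro mult_left_mono) auto
        finally have "dist_K \<pi> \<sigma> < \<epsilon>" using choose(2) Np by simp
        moreover have "dist_K_property \<pi> P \<le> ereal (dist_K \<pi> \<sigma>)"
          unfolding dist_K_property_def using \<sigma> Np by (intro INF_lower) auto
        ultimately show False using dist by (metis ereal_less_eq(3) not_less order_trans)
      qed
    qed
  qed
qed

end
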